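(* Let $X$ be a real normed space, let $C\subset X$ be a closed convex cone, let $u\in S_X\cap\operatorname{int}C$, and assume that $C\subset\operatorname{cone}B(u,\varepsilon)$ for some $0<\varepsilon<1$. For every $f\in S_{X^*}$ with $f(u)=1$, there exists a continuous, positively homogeneous and subadditive mapping $D_{C,u,f}:X\to[0,+\infty)$ which is transversally coercive at $(u,f)$ and satisfies \[ C=\{x\in X:D_{C,u,f}(x)\le f(x)\}. \] More precisely, $D_{C,u,f}$ may be chosen with transversal coercivity constant $c_{u,f}=\frac{1-\varepsilon}{2\varepsilon}$. Consequently, $\varphi_{C,u,f}:=f-D_{C,u,f}$ is a continuous superlinear adapted defining function for $C$ at $u$.
   Context: $S_X$, $S_{X^*}$ are the unit spheres of $X$ and $X^*$, $B(x,r)=\{y\in X:\|y-x\|\le r\}$, $\operatorname{cone}(A)=\{ta:t\ge0,\ a\in A\}$. A nonempty set $C\subset X$ is a cone if $tC\subset C$ for every $t\ge 0$; all cones are assumed proper, i.e. $\{0_X\}\subsetneq C\subsetneq X$. A norming pair is $(u,f)\in S_X\times S_{X^*}$ with $f(u)=1$; put $Q_{u,f}x:=x-f(x)u$. A continuous positively homogeneous mapping $D:X\to[0,+\infty)$ is transversally coercive at $(u,f)$ with transversal coercivity constant $c>0$ if $D(u)=0$ and $D(x)\ge c\|Q_{u,f}x\|$ whenever $f(x)\ge0$. Positively homogeneous: $\varphi(tx)=t\varphi(x)$ for all $t\ge0$; subadditive: $p(x+y)\le p(x)+p(y)$; superlinear: positively homogeneous and $\varphi(x+y)\ge\varphi(x)+\varphi(y)$.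 An adapted defining function for $C$ at $u\in S_X\cap\operatorname{int}C$ is a continuous positively homogeneous $\varphi:X\to\mathbb R$ with $C=\{\varphi\ge0\}$, $\varphi(u)=1$, and $\varphi(x)\le\|x\|$ for every $x\in X$. *)

theory Defs
  imports "HOL-Analysis.Analysis"
begin

definition proper_cone :: "'a::real_normed_vector set \<Rightarrow> bool" where
  "proper_cone C \<longleftrightarrow> cone C \<and> {0} \<subset> C \<and> C \<subset> UNIV"

definition generated_cone :: "'a::real_normed_vector set \<Rightarrow> 'a set" where
  "generated_cone A = {t *\<^sub>R a | t a. t \<ge> 0 \<and> a \<in> A}"

text \<open>The topological dual is the type of bounded linear functionals with its operator norm.\<close>

definition norming_pair :: "'a::real_normed_vector \<Rightarrow> ('a \<Rightarrow>\<^sub>L real) \<Rightarrow> bool" where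
  "norming_pair u f \<longleftrightarrow> u \<in> sphere 0 1 \<and> f \<in> sphere 0 1 \<and> blinfun_apply f u = 1"

definition transversal_part ::
    "'a::real_normed_vector \<Rightarrow> ('a \<Rightarrow>\<^sub>L real) \<Rightarrow> 'a \<Rightarrow> 'a" where
  "transversal_part u f x = x - blinfun_apply f x *\<^sub>R u"

definition pos_homogeneous :: "('a::real_normed_vector \<Rightarrow> real) \<Rightarrow> bool" where
  "pos_homogeneous p \<longleftrightarrow> (\<forall>t\<ge>0. \<forall>x. p (t *\<^sub>R x) = t * p x)"

definition subadditive_fun :: "('a::real_normed_vector \<Rightarrow> real) \<Rightarrow> bool" where
  "subadditive_fun p \<longleftrightarrow> (\<forall>x y. p (x + y) \<le> p x + p y)"

definition superlinear :: "('a::real_normed_vector \<Rightarrow> real) \<Rightarrow> bool" where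
  "superlinear p \<longleftrightarrow> pos_homogeneous p \<and> (\<forall>x y. p (x + y) \<ge> p x + p y)"

definition transversally_coercive ::
    "'a::real_normed_vector \<Rightarrow> ('a \<Rightarrow>\<^sub>L real) \<Rightarrow> real \<Rightarrow> ('a \<Rightarrow> real) \<Rightarrow> bool" where
  "transversally_coercive u f c D \<longleftrightarrow>
     norming_pair u f \<and> continuous_on UNIV D \<and> pos_homogeneous D \<and> (\<forall>x. D x \<ge> 0) \<and>
     c > 0 \<and> D u = 0 \<and>
     (\<forall>x. blinfun_apply f x \<ge> 0 \<longrightarrow> D x \<ge> c * norm (transversal_part u f x))"

definition adapted_defining_function ::
    "'a::real_normed_vector set \<Rightarrow> 'a \<Rightarrow> ('a \<Rightarrow> real) \<Rightarrow> bool" where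
  "adapted_defining_function C u p \<longleftrightarrow>
     u \<in> sphere 0 1 \<inter> interior C \<and> continuous_on UNIV p \<and> pos_homogeneous p \<and>
     C = {x. p x \<ge> 0} \<and> p u = 1 \<and> (\<forall>x. p x \<le> norm x)"

end

theory Submission
  imports Defs
begin

text \<open>
  Every \<open>x\<close> has a least \<open>s\<close> with \<open>x + s u \<in> C\<close>; call it \<open>h x\<close>. It is a continuous sublinear
  function of \<open>x\<close> with \<open>C = {h \<le> 0}\<close>, and \<open>D = f + h\<close> is the required function: coercivity of
  \<open>D\<close> is the estimate \<open>f y \<ge> c \<parallel>Q y\<parallel>\<close> for \<open>y \<in> C\<close> evaluated at \<open>y = x + h x u\<close>, because
  \<open>f y = D x\<close> and \<open>Q y = Q x\<close>. On \<open>C\<close> that estimate holds because \<open>y = t a\<close> with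
  \<open>\<parallel>a - u\<parallel> \<le> \<epsilon>\<close> gives \<open>f y \<ge> t (1 - \<epsilon>)\<close> and \<open>\<parallel>Q y\<parallel> = t \<parallel>Q (a - u)\<parallel> \<le> 2 t \<epsilon>\<close>.
\<close>

text \<open>Subadditivity gives \<open>p x - p y \<le> p (x - y)\<close>, which the linear bound
  controls; exchanging \<open>x\<close> and \<open>y\<close> makes \<open>p\<close> Lipschitz. The
  constant is \<open>\<bar>K\<bar>\<close> because the sign of \<open>K\<close> is not
  prescribed.\<close>

lemma subadditive_imp_continuous:
  fixes p :: "'a::real_normed_vector \<Rightarrow> real"
  assumes sub: "\<And>x y. p (x + y) \<le> p x + p y" and bound: "\<And>x. p x \<le> K * norm x"
  shows "continuous_on UNIV p"
proof -
  have diff: "p x - p y \<le> K * norm (x - y)" for x y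
    using sub[of "x - y" y] bound[of "x - y"] by simp
  have "\<bar>p x - p y\<bar> \<le> \<bar>K\<bar> * norm (x - y)" for x y
  proof -
    have "K * norm (x - y) \<le> \<bar>K\<bar> * norm (x - y)"
      by (intro mult_right_mono) auto
    then show ?thesis
      using diff[of x y] diff[of y x] by (simp add: norm_minus_commute abs_le_iff)
  qed
  then have "\<bar>K\<bar>-lipschitz_on UNIV p"
    by (intro lipschitz_onI) (auto simp: dist_norm)
  then show ?thesis
    by (rule lipschitz_on_continuous_on)
qed

text \<open>The enclosing ball cone enters here only through \<open>f_nonneg\<close>, which keeps
  downward shifts along \<open>u\<close> from staying in \<open>C\<close> forever.\<close>

locale solid_cone =
  fixes C :: "'a::real_normed_vector set" and u :: 'a and f :: "'a \<Rightarrow>\<^sub>L real"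
  assumes cone: "cone C" and closed: "closed C" and convex: "convex C"
    and interior: "u \<in> interior C"
    and f_nonneg: "\<And>x. x \<in> C \<Longrightarrow> 0 \<le> blinfun_apply f x"
    and f_unit: "blinfun_apply f u = 1"
begin

text \<open>This is the Gerstewitz (Tammer) scalarization functional of \<open>C\<close> in
  direction \<open>u\<close>, evaluated at \<open>- x\<close>.\<close>

definition height :: "'a \<Rightarrow> real" where
  "height x = Inf {s. x + s *\<^sub>R u \<in> C}"

lemma cone_add: "x \<in> C \<Longrightarrow> y \<in> C \<Longrightarrow> x + y \<in> C"
  using convex_cone[of C] convex cone by blast

lemma cone_scale: "x \<in> C \<Longrightarrow> 0 \<le> t \<Longrightarrow> t *\<^sub>R x \<in> C"
  using cone by (simp add: cone_def)

lemma zero_in_cone: "0 \<in> C"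
  using cone_scale[of u 0] interior interior_subset by auto

text \<open>A ball of radius \<open>r\<close> about \<open>u\<close> lies in \<open>C\<close>, so
  \<open>K = 1 / r\<close> works after rescaling. The result makes the set defining
  \<open>height x\<close> nonempty and bounds \<open>height\<close> linearly, as continuity
  requires.\<close>

lemma ex_linear_shift: "\<exists>K. \<forall>x. x + (K * norm x) *\<^sub>R u \<in> C"
proof -
  obtain r where r: "r > 0" "cball u r \<subseteq> C"
    using interior by (auto simp: mem_interior_cball)
  have "x + (1 / r * norm x) *\<^sub>R u \<in> C" for x
  proof (cases "x = 0")
    case True
    then show ?thesis by (simp add: zero_in_cone)
  next
    case False
    have "u + (r / norm x) *\<^sub>R x \<in> cball u r"
      using False r by (simp add: dist_norm)
    then have "(norm x / r) *\<^sub>R (u + (r / norm x) *\<^sub>R x) \<in> C"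
      using r by (intro cone_scale) auto
    then show ?thesis
      using False r by (simp add: scaleR_add_right add.commute)
  qed
  then show ?thesis
    by blast
qed

text \<open>The admissible shifts form a closed set bounded below by \<open>- f x\<close>, so the
  infimum is attained; adding multiples of \<open>u \<in> C\<close> shows that the set is upward
  closed. Claims about \<open>height\<close> thereby become membership claims.\<close>

lemma height_le_iff: "height x \<le> s \<longleftrightarrow> x + s *\<^sub>R u \<in> C"
proof -
  let ?S = "{s. x + s *\<^sub>R u \<in> C}"
  have lower: "- blinfun_apply f x \<le> s" if "s \<in> ?S" for s
    using f_nonneg[of "x + s *\<^sub>R u"] that
    by (simp add: blinfun.add_right blinfun.scaleR_right f_unit)
  then have bdd: "bdd_below ?S"
    by (meson bdd_belowI)
  have "closed ((\<lambda>s. x + s *\<^sub>R u) -` C)"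
    by (intro continuous_closed_vimage closed) (auto intro!: continuous_intros)
  then have "Inf ?S \<in> ?S"
    using ex_linear_shift bdd by (intro closed_contains_Inf) (auto simp: vimage_def)
  then have attained: "x + height x *\<^sub>R u \<in> C"
    by (simp add: height_def)
  show ?thesis
  proof
    assume "height x \<le> s"
    then have "(s - height x) *\<^sub>R u \<in> C"
      using interior interior_subset by (intro cone_scale) auto
    from cone_add[OF attained this] show "x + s *\<^sub>R u \<in> C"
      by (simp add: algebra_simps)
  next
    assume "x + s *\<^sub>R u \<in> C"
    then show "height x \<le> s"
      unfolding height_def using bdd by (intro cInf_lower) auto
  qed
qed

lemma add_height_in_cone: "x + height x *\<^sub>R u \<in> C"
  using height_le_iff[of x "height x"] by simp

lemma height_nonpos_iff: "height x \<le> 0 \<longleftrightarrow> x \<in> C"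
  using height_le_iff[of x 0] by simp

lemma height_lower: "0 \<le> blinfun_apply f x + height x"
  using f_nonneg[OF add_height_in_cone[of x]]
  by (simp add: blinfun.add_right blinfun.scaleR_right f_unit)

lemma height_subadditive: "height (x + y) \<le> height x + height y"
  using cone_add[OF add_height_in_cone[of x] add_height_in_cone[of y]]
  by (simp add: height_le_iff algebra_simps)

lemma height_scale:
  assumes "0 \<le> t"
  shows "height (t *\<^sub>R x) = t * height x"
proof (cases "t = 0")
  case True
  then show ?thesis
    using height_lower[of 0] height_nonpos_iff[of 0] zero_in_cone by simp
next
  case False
  with assms have t: "t > 0" by simp
  have le: "height (t *\<^sub>R x) \<le> t * height x" if "t > 0" for t x
    using cone_scale[OF add_height_in_cone[of x], of t] that
    by (simp add: height_le_iff algebra_simps)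
  \<comment> \<open>The reverse inequality is \<open>le\<close> with factor \<open>1 / t\<close>,
    applied to the vector \<open>t *\<^sub>R x\<close>.\<close>
  have "height x \<le> (1 / t) * height (t *\<^sub>R x)"
    using le[of "1 / t" "t *\<^sub>R x"] t by simp
  then have "t * height x \<le> height (t *\<^sub>R x)"
    using t by (simp add: field_simps)
  then show ?thesis
    using le[OF t, of x] by simp
qed

lemma height_unit: "height u = - 1"
proof (rule antisym)
  show "height u \<le> - 1"
    using zero_in_cone by (simp add: height_le_iff)
  show "- 1 \<le> height u"
    using height_lower[of u] f_unit by simp
qed

lemma height_continuous: "continuous_on UNIV height"
proof -
  obtain K where "\<forall>x. x + (K * norm x) *\<^sub>R u \<in> C"
    using ex_linear_shift by blast
  then show ?thesis
    by (intro subadditive_imp_continuous[of _ K] height_subadditive) (simp add: height_le_iff)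
qed

end

lemma norming_pair_coercive_on_generated_cone:
  assumes pair: "norming_pair u f" and eps: "0 < \<epsilon>" "\<epsilon> < 1"
    and y: "y \<in> generated_cone (cball u \<epsilon>)"
  shows "(1 - \<epsilon>) / (2 * \<epsilon>) * norm (transversal_part u f y) \<le> blinfun_apply f y"
proof -
  have norms: "norm u = 1" "norm f = 1" and fu: "blinfun_apply f u = 1"
    using pair by (auto simp: norming_pair_def)
  obtain t a where t: "t \<ge> 0" and a: "norm (a - u) \<le> \<epsilon>" and y_eq: "y = t *\<^sub>R a"
    using y by (auto simp: generated_cone_def dist_norm norm_minus_commute)
  have fa: "\<bar>blinfun_apply f a - 1\<bar> \<le> \<epsilon>"
    using norm_blinfun[of f "a - u"] a norms fu by (simp add: blinfun.diff_right)
  have "transversal_part u f y = t *\<^sub>R ((a - u) - (blinfun_apply f a - 1) *\<^sub>R u)"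
    by (simp add: transversal_part_def y_eq blinfun.scaleR_right algebra_simps)
  \<comment> \<open>The factor 2 arises because both \<open>a - u\<close> and its component along
    \<open>u\<close> have norm at most \<epsilon>.\<close>
  moreover have "norm ((a - u) - (blinfun_apply f a - 1) *\<^sub>R u) \<le> 2 * \<epsilon>"
    using norm_triangle_ineq4[of "a - u" "(blinfun_apply f a - 1) *\<^sub>R u"] a fa norms by simp
  ultimately have "norm (transversal_part u f y) \<le> t * (2 * \<epsilon>)"
    using t by (simp add: mult_left_mono)
  then have "(1 - \<epsilon>) / (2 * \<epsilon>) * norm (transversal_part u f y)
      \<le> (1 - \<epsilon>) / (2 * \<epsilon>) * (t * (2 * \<epsilon>))"
    using eps by (intro mult_left_mono) auto
  also have "\<dots> = t * (1 - \<epsilon>)"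
    using eps by simp
  also have "\<dots> \<le> t * blinfun_apply f a"
    using fa t by (intro mult_left_mono) auto
  finally show ?thesis
    by (simp add: y_eq blinfun.scaleR_right)
qed

theorem proposition5p3:
  fixes C :: "'a::real_normed_vector set" and u :: 'a and \<epsilon> :: real
    and f :: "'a \<Rightarrow>\<^sub>L real"
  assumes "proper_cone C" and "closed C" and "convex C"
    and "u \<in> sphere 0 1 \<inter> interior C"
    and "0 < \<epsilon>" and "\<epsilon> < 1"
    and "C \<subseteq> generated_cone (cball u \<epsilon>)"
    and "f \<in> sphere 0 1" and "blinfun_apply f u = 1"
  shows "\<exists>D :: 'a \<Rightarrow> real.
      continuous_on UNIV D \<and> pos_homogeneous D \<and> subadditive_fun D \<and> (\<forall>x. D x \<ge> 0) \<and>
      transversally_coercive u f ((1 - \<epsilon>) / (2 * \<epsilon>)) D \<and>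
      C = {x. D x \<le> blinfun_apply f x} \<and>
      superlinear (\<lambda>x. blinfun_apply f x - D x) \<and>
      adapted_defining_function C u (\<lambda>x. blinfun_apply f x - D x)"
proof -
  let ?c = "(1 - \<epsilon>) / (2 * \<epsilon>)"
  have c: "?c > 0"
    using assms by simp
  have pair: "norming_pair u f"
    using assms by (simp add: norming_pair_def)
  have coercive: "?c * norm (transversal_part u f y) \<le> blinfun_apply f y" if "y \<in> C" for y
    using norming_pair_coercive_on_generated_cone[OF pair] assms that by blast
  interpret solid_cone C u f
  proof
    \<comment> \<open>Nonnegativity of \<open>f\<close> on \<open>C\<close> follows from the
      coercivity estimate, since its left-hand side is nonnegative.\<close>
    show "0 \<le> blinfun_apply f x" if "x \<in> C" for x
      using coercive[OF that] c
      by (meson less_imp_le mult_nonneg_nonneg norm_ge_zero order_trans)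
  qed (use assms in \<open>auto simp: proper_cone_def\<close>)
  define D where "D x = blinfun_apply f x + height x" for x
  have cont: "continuous_on UNIV D"
    unfolding D_def by (intro continuous_intros height_continuous)
  have hom: "pos_homogeneous D"
    by (simp add: pos_homogeneous_def D_def height_scale blinfun.scaleR_right algebra_simps)
  have sub: "subadditive_fun D"
    using height_subadditive by (simp add: subadditive_fun_def D_def blinfun.add_right)
  have nonneg: "D x \<ge> 0" for x
    using height_lower by (simp add: D_def)
  have D_coercive: "?c * norm (transversal_part u f x) \<le> D x" for x
  proof -
    \<comment> \<open>Shifting along \<open>u\<close> leaves the transversal part unchanged because
      \<open>f u = 1\<close>. The resulting bound holds for all \<open>x\<close>, whatever the sign
      of \<open>f x\<close>.\<close>
    have "transversal_part u f (x + height x *\<^sub>R u) = transversal_part u f x"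
      by (simp add: transversal_part_def blinfun.add_right blinfun.scaleR_right f_unit
          algebra_simps)
    then show ?thesis
      using coercive[OF add_height_in_cone[of x]]
      by (simp add: D_def blinfun.add_right blinfun.scaleR_right f_unit)
  qed
  have trans: "transversally_coercive u f ?c D"
    unfolding transversally_coercive_def
    using pair cont hom nonneg c D_coercive by (simp add: D_def f_unit height_unit)
  \<comment> \<open>The functional \<open>f\<close> cancels, so the remaining claims reduce to
    properties of \<open>height\<close>.\<close>
  have phi: "(\<lambda>x. blinfun_apply f x - D x) = (\<lambda>x. - height x)"
    by (simp add: D_def)
  \<comment> \<open>Nonnegativity of \<open>D\<close> gives \<open>- height x \<le> f x\<close>, and
    \<open>f\<close> has norm 1.\<close>
  have "- height x \<le> norm x" for x
    using height_lower[of x] norm_blinfun[of f x] assms by simp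
  then have adapted: "adapted_defining_function C u (\<lambda>x. - height x)"
    using assms height_continuous
    by (auto simp: adapted_defining_function_def pos_homogeneous_def height_scale height_unit
        height_nonpos_iff intro!: continuous_intros)
  have super: "superlinear (\<lambda>x. - height x)"
  proof -
    have "- height x + - height y \<le> - height (x + y)" for x y
      using height_subadditive[of x y] by linarith
    then show ?thesis
      by (simp add: superlinear_def pos_homogeneous_def height_scale)
  qed
  have "C = {x. D x \<le> blinfun_apply f x}"
    by (simp add: D_def height_nonpos_iff)
  then show ?thesis
    using cont hom sub nonneg trans super adapted
    by (intro exI[of _ D]) (simp only: phi, simp)
qed

end
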